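(* Let $d\geq 1$ be an integer, let $1\leq p<q<\infty$ and $1\leq s<\infty$, and let $\ell^p_q=\ell^p_q(\mathbb{Z}^d)$ be the discrete Morrey space with norm $\Vert\cdot\Vert_{\ell^p_q}$. Then $$ C_{NJ}^{(s)}(\ell^p_q) = C'_{NJ}(\ell^p_q) = \bar{C}_{NJ}^{(s)}(\ell^p_q) = C_{-\infty}(\ell^p_q) = C_{-\infty}^{(s)}(\ell^p_q) = C_Z(\ell^p_q) = C_Z^{(s)}(\ell^p_q) = 2 . $$
   Context: Discrete Morrey spaces. Let $d\geq 1$ be an integer and $\omega:=\mathbb{N}\cup\{0\}$. For $m=(m_1,\dots,m_d)\in\mathbb{Z}^d$ put $\Vert m\Vert_\infty:=\max\{|m_j| : 1\leq j\leq d\}$, and for $m\in\mathbb{Z}^d$, $N\in\omega$ put $$S_{m,N}:=\{k\in\mathbb{Z}^d : \Vert k-m\Vert_\infty\leq N\},$$ whose cardinality is $|S_{m,N}|=(2N+1)^d$. For $1\leq p\leq q<\infty$, $\ell^p_q=\ell^p_q(\mathbb{Z}^d)$ is the set of all functions $x:\mathbb{Z}^d\to\mathbb{R}$ such that $$\Vert x\Vert_{\ell^p_q}:=\sup_{m\in\mathbb{Z}^d,\,N\in\omega}|S_{m,N}|^{\frac1q-\frac1p}\Big(\sum_{k\in S_{m,N}}|x(k)|^p\Big)^{\frac1p}<\infty.$$ It is a real Banach space with this norm. Geometric constants. For a Banach space $(X,\Vert\cdot\Vert_X)$ and a fixed $1\leq s<\infty$: Generalized von Neumann-Jordan constant: $$C_{NJ}^{(s)}(X):=\sup\left\{\frac{\Vert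 x+y\Vert_X^s+\Vert x-y\Vert_X^s}{2^{s-1}(\Vert x\Vert_X^s+\Vert y\Vert_X^s)} : x,y\in X\setminus\{0\}\right\}.$$ Modified von Neumann-Jordan constant: $$C'_{NJ}(X):=\sup\left\{\frac{\Vert x+y\Vert_X^2+\Vert x-y\Vert_X^2}{4} : x,y\in X,\ \Vert x\Vert_X=\Vert y\Vert_X=1\right\}.$$ Generalized modified von Neumann-Jordan constant: $$\bar{C}_{NJ}^{(s)}(X):=\sup\left\{\frac{\Vert x+y\Vert_X^s+\Vert x-y\Vert_X^s}{2^s} : x,y\in X,\ \Vert x\Vert_X=\Vert y\Vert_X=1\right\}.$$ von Neumann-Jordan type constant: $$C_{-\infty}(X):=\sup\left\{\frac{\min\{\Vert x+y\Vert_X^2,\Vert x-y\Vert_X^2\}}{\Vert x\Vert_X^2+\Vert y\Vert_X^2} : x,y\in X\setminus\{0\}\right\}.$$ Generalized von Neumann-Jordan type constant: $$C_{-\infty}^{(s)}(X):=\sup\left\{\frac{\min\{\Vert x+y\Vert_X^s,\Vert x-y\Vert_X^s\}}{2^{s-2}(\Vert x\Vert_X^s+\Vert y\Vert_X^s)} : x,y\in X\setminus\{0\}\right\}.$$ Zbăganu constant: $$C_Z(X):=\sup\left\{\frac{\Vert x+y\Vert_X\,\Vert x-y\Vert_X}{\Vert x\Vert_X^2+\Vert y\Vert_X^2} : x,y\in X\setminus\{0\}\right\}.$$ Generalized Zbăganu constant: $$C_Z^{(s)}(X):=\sup\left\{\frac{\Vert x+y\Vert_X^{s/2}\,\Vert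 x-y\Vert_X^{s/2}}{2^{s-2}(\Vert x\Vert_X^s+\Vert y\Vert_X^s)} : x,y\in X\setminus\{0\}\right\}.$$ *)

theory Defs
  imports "HOL-Analysis.Analysis" "HOL-Library.Function_Algebras"
begin

text \<open>
  The dimension $d \geq 1$ is \<open>CARD('d)\<close>, and $\mathbb{Z}^d$ is \<^typ>\<open>int ^ 'd::finite\<close>.
  Since all real powers below have nonnegative bases and, where the base can vanish, positive
  exponents, the convention \<open>0 powr a = 0\<close> agrees with the usual one.
\<close>

definition linf_norm :: "int ^ 'd::finite \<Rightarrow> int" where
  "linf_norm m = Max {\<bar>m $ j\<bar> | j. True}"

definition cube :: "int ^ 'd::finite \<Rightarrow> nat \<Rightarrow> (int ^ 'd) set" where
  "cube m N = {k. linf_norm (k - m) \<le> int N}"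

text \<open>The supremum is taken in \<^typ>\<open>ereal\<close>, so that it is \<open>\<infinity>\<close> outside the Morrey space.\<close>

definition morrey_enorm :: "real \<Rightarrow> real \<Rightarrow> (int ^ 'd::finite \<Rightarrow> real) \<Rightarrow> ereal" where
  "morrey_enorm p q x =
     Sup {ereal (real (card (cube m N)) powr (1 / q - 1 / p)
                 * (\<Sum>k\<in>cube m N. \<bar>x k\<bar> powr p) powr (1 / p)) | m N. True}"

definition morrey_space :: "real \<Rightarrow> real \<Rightarrow> (int ^ 'd::finite \<Rightarrow> real) set" where
  "morrey_space p q = {x. morrey_enorm p q x < \<infinity>}"

definition morrey_norm :: "real \<Rightarrow> real \<Rightarrow> (int ^ 'd::finite \<Rightarrow> real) \<Rightarrow> real" where
  "morrey_norm p q x = real_of_ereal (morrey_enorm p q x)"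

text \<open>
  The exponents $p$, $q$ are real parameters, so the Morrey spaces cannot be instances of the
  class \<^class>\<open>banach\<close>. The geometric constants are therefore defined for a space given by
  its carrier \<open>X\<close> and its norm \<open>nrm\<close>; they are meant for a subspace \<open>X\<close> of the ambient type on
  which \<open>nrm\<close> is a complete norm. They only mention addition, subtraction and \<open>0\<close>, which on
  functions are pointwise. As suprema in \<^typ>\<open>ereal\<close> they are meaningful without a
  boundedness proof.
\<close>

definition gen_NJ_const :: "real \<Rightarrow> 'a::ab_group_add set \<Rightarrow> ('a \<Rightarrow> real) \<Rightarrow> ereal" where
  "gen_NJ_const s X nrm =
     Sup {ereal ((nrm (x + y) powr s + nrm (x - y) powr s)
                 / (2 powr (s - 1) * (nrm x powr s + nrm y powr s)))
          | x y. x \<in> X - {0} \<and> y \<in> X - {0}}"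

definition mod_NJ_const :: "'a::ab_group_add set \<Rightarrow> ('a \<Rightarrow> real) \<Rightarrow> ereal" where
  "mod_NJ_const X nrm =
     Sup {ereal (((nrm (x + y))\<^sup>2 + (nrm (x - y))\<^sup>2) / 4)
          | x y. x \<in> X \<and> y \<in> X \<and> nrm x = 1 \<and> nrm y = 1}"

definition gen_mod_NJ_const :: "real \<Rightarrow> 'a::ab_group_add set \<Rightarrow> ('a \<Rightarrow> real) \<Rightarrow> ereal" where
  "gen_mod_NJ_const s X nrm =
     Sup {ereal ((nrm (x + y) powr s + nrm (x - y) powr s) / 2 powr s)
          | x y. x \<in> X \<and> y \<in> X \<and> nrm x = 1 \<and> nrm y = 1}"

definition NJ_type_const :: "'a::ab_group_add set \<Rightarrow> ('a \<Rightarrow> real) \<Rightarrow> ereal" where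
  "NJ_type_const X nrm =
     Sup {ereal (min ((nrm (x + y))\<^sup>2) ((nrm (x - y))\<^sup>2) / ((nrm x)\<^sup>2 + (nrm y)\<^sup>2))
          | x y. x \<in> X - {0} \<and> y \<in> X - {0}}"

definition gen_NJ_type_const :: "real \<Rightarrow> 'a::ab_group_add set \<Rightarrow> ('a \<Rightarrow> real) \<Rightarrow> ereal" where
  "gen_NJ_type_const s X nrm =
     Sup {ereal (min (nrm (x + y) powr s) (nrm (x - y) powr s)
                 / (2 powr (s - 2) * (nrm x powr s + nrm y powr s)))
          | x y. x \<in> X - {0} \<and> y \<in> X - {0}}"

definition Zbaganu_const :: "'a::ab_group_add set \<Rightarrow> ('a \<Rightarrow> real) \<Rightarrow> ereal" where
  "Zbaganu_const X nrm =
     Sup {ereal (nrm (x + y) * nrm (x - y) / ((nrm x)\<^sup>2 + (nrm y)\<^sup>2))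
          | x y. x \<in> X - {0} \<and> y \<in> X - {0}}"

definition gen_Zbaganu_const :: "real \<Rightarrow> 'a::ab_group_add set \<Rightarrow> ('a \<Rightarrow> real) \<Rightarrow> ereal" where
  "gen_Zbaganu_const s X nrm =
     Sup {ereal (nrm (x + y) powr (s / 2) * nrm (x - y) powr (s / 2)
                 / (2 powr (s - 2) * (nrm x powr s + nrm y powr s)))
          | x y. x \<in> X - {0} \<and> y \<in> X - {0}}"

end

theory Submission
  imports Defs
begin

text \<open>
  In any normed space the triangle inequality gives \<open>\<parallel>x \<plusminus> y\<parallel> \<le> \<parallel>x\<parallel> + \<parallel>y\<parallel>\<close>, and convexity of
  \<open>t \<mapsto> t\<^sup>s\<close> turns this into \<open>\<parallel>x \<plusminus> y\<parallel>\<^sup>s \<le> 2\<^bsup>s-1\<^esup> (\<parallel>x\<parallel>\<^sup>s + \<parallel>y\<parallel>\<^sup>s)\<close>. Each of the seven constants is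
  normalised so that this one estimate bounds it by \<open>2\<close>. The bound is attained in every one of
  them as soon as there are unit vectors \<open>u\<close>, \<open>v\<close> with \<open>\<parallel>u + v\<parallel> = \<parallel>u - v\<parallel> = 2\<close>, as for
  \<open>(1, 1)\<close> and \<open>(1, -1)\<close> in the plane with the maximum norm. The locale \<open>exact_square\<close> collects this argument.

  A Morrey space with \<open>p < q\<close> contains such a pair because the weight \<open>|S|\<^bsup>1/q - 1/p\<^esup>\<close> tends to \<open>0\<close>
  as the cube \<open>S\<close> grows. Two point masses at a large distance can only be seen together by a cube
  so large that its weight compensates the sum of the two masses, so the norm of the pair is the
  larger of the two absolute values, as in the plane above. Hence \<open>u = \<delta>\<^sub>a + \<delta>\<^sub>b\<close> and \<open>v = \<delta>\<^sub>a - \<delta>\<^sub>b\<close> have norm \<open>1\<close>, while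
  \<open>u + v = 2 \<delta>\<^sub>a\<close> and \<open>u - v = 2 \<delta>\<^sub>b\<close> have norm \<open>2\<close>.

  The triangle inequality for the Morrey norm is Minkowski's inequality on each cube
  (\<open>Minkowski_sum\<close>), and the computation of the norm of two distant point masses is
  \<open>morrey_norm_point_pair\<close>.
\<close>

section \<open>Convexity of powers and Minkowski's inequality\<close>

text \<open>
  The fact \<open>powr_convex\<close> lives on the open half-line. At an endpoint \<open>0\<close> convexity reduces to
  \<open>r\<^sup>p \<le> r\<close> for \<open>0 \<le> r \<le> 1\<close>.
\<close>

lemma powr_convex_nonneg:
  fixes a b p t :: real
  assumes "1 \<le> p" "0 \<le> a" "0 \<le> b" "0 \<le> t" "t \<le> 1"
  shows "((1 - t) * a + t * b) powr p \<le> (1 - t) * a powr p + t * b powr p"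
proof -
  have scale: "(r * c) powr p \<le> r * c powr p" if "0 \<le> r" "r \<le> 1" "0 \<le> c" for r c :: real
  proof (cases "r = 0")
    case False
    then have "r powr p \<le> r powr 1" using that assms by (intro powr_mono') auto
    then show ?thesis using that by (simp add: powr_mult mult_right_mono)
  qed simp
  consider "a = 0" | "b = 0" | "0 < a" "0 < b" using assms by linarith
  then show ?thesis
  proof cases
    case 3
    then show ?thesis
      using convex_onD[OF powr_convex[OF assms(1)], of t a b] assms by simp
  qed (use assms scale[of t b] scale[of "1 - t" a] in simp_all)
qed

lemma add_powr_le:
  fixes a b s :: real
  assumes "1 \<le> s" "0 \<le> a" "0 \<le> b"
  shows "(a + b) powr s \<le> 2 powr (s - 1) * (a powr s + b powr s)"
proof -
  have "((a + b) / 2) powr s \<le> (a powr s + b powr s) / 2"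
    using powr_convex_nonneg[OF assms, of "1/2"] by (simp add: field_simps)
  then show ?thesis
    using assms by (simp add: powr_divide powr_diff field_simps)
qed

text \<open>
  With \<open>a\<close> and \<open>b\<close> the \<open>p\<close>-norms of \<open>x\<close> and \<open>y\<close>, the normalised sum \<open>(x + y) / (a + b)\<close> is the
  convex combination of \<open>x / a\<close> and \<open>y / b\<close> with weights \<open>a / (a + b)\<close> and \<open>b / (a + b)\<close>. Summing
  the pointwise convexity estimate over \<open>A\<close> gives at most \<open>1\<close>, because \<open>x / a\<close> and \<open>y / b\<close>
  have \<open>p\<close>-norm \<open>1\<close>.
\<close>

lemma Minkowski_sum:
  fixes x y :: "'a \<Rightarrow> real"
  assumes "1 \<le> p" "finite A"
  shows "(\<Sum>k\<in>A. \<bar>x k + y k\<bar> powr p) powr (1/p)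
           \<le> (\<Sum>k\<in>A. \<bar>x k\<bar> powr p) powr (1/p) + (\<Sum>k\<in>A. \<bar>y k\<bar> powr p) powr (1/p)"
    (is "?S powr _ \<le> ?X powr _ + ?Y powr _")
proof -
  define a where "a = ?X powr (1/p)"
  define b where "b = ?Y powr (1/p)"
  have nonneg: "0 \<le> ?X" "0 \<le> ?Y" "0 \<le> ?S" "0 \<le> a" "0 \<le> b"
    by (auto simp: a_def b_def intro!: sum_nonneg)
  have ap: "a powr p = ?X" and bp: "b powr p = ?Y"
    using assms nonneg by (auto simp: a_def b_def powr_powr)
  have zero: "z k = 0" if "(\<Sum>k\<in>A. \<bar>z k\<bar> powr p) powr (1/p) = 0" "k \<in> A" for z :: "'a \<Rightarrow> real" and k
  proof -
    have "(\<Sum>k\<in>A. \<bar>z k\<bar> powr p) = 0" using that by simp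
    then show ?thesis
      using sum_nonneg_eq_0_iff[OF \<open>finite A\<close>, of "\<lambda>k. \<bar>z k\<bar> powr p"] that by auto
  qed
  consider "a = 0" | "b = 0" | "0 < a" "0 < b" using nonneg by linarith
  then show ?thesis
  proof cases
    case 1
    then have "\<And>k. k \<in> A \<Longrightarrow> x k = 0" unfolding a_def using zero by blast
    then show ?thesis by simp
  next
    case 2
    then have "\<And>k. k \<in> A \<Longrightarrow> y k = 0" unfolding b_def using zero by blast
    then show ?thesis by simp
  next
    case 3
    define t where "t = b / (a + b)"
    have one_minus_t: "1 - t = a / (a + b)" using 3 by (simp add: t_def diff_divide_eq_iff)
    have t: "0 \<le> t" "t \<le> 1" using 3 by (simp_all add: t_def)
    have pt: "\<bar>x k + y k\<bar> powr p
        \<le> (a + b) powr p * ((1 - t) * (\<bar>x k\<bar> powr p / ?X) + t * (\<bar>y k\<bar> powr p / ?Y))" for k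
    proof -
      have "\<bar>x k\<bar> + \<bar>y k\<bar> = (a + b) * ((1 - t) * (\<bar>x k\<bar> / a) + t * (\<bar>y k\<bar> / b))"
        unfolding one_minus_t unfolding t_def using 3 by (simp add: distrib_left)
      then have "\<bar>x k + y k\<bar> \<le> (a + b) * ((1 - t) * (\<bar>x k\<bar> / a) + t * (\<bar>y k\<bar> / b))"
        using abs_triangle_ineq[of "x k" "y k"] by simp
      then have "\<bar>x k + y k\<bar> powr p \<le> ((a + b) * ((1 - t) * (\<bar>x k\<bar> / a) + t * (\<bar>y k\<bar> / b))) powr p"
        using assms by (intro powr_mono2) auto
      also have "\<dots> = (a + b) powr p * ((1 - t) * (\<bar>x k\<bar> / a) + t * (\<bar>y k\<bar> / b)) powr p"
        by (rule powr_mult)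
      also have "\<dots> \<le> (a + b) powr p * ((1 - t) * (\<bar>x k\<bar> / a) powr p + t * (\<bar>y k\<bar> / b) powr p)"
        using powr_convex_nonneg[OF assms(1), of "\<bar>x k\<bar> / a" "\<bar>y k\<bar> / b" t] 3 t
        by (intro mult_left_mono) auto
      finally show ?thesis using 3 by (simp add: powr_divide ap bp)
    qed
    have pos: "0 < ?X" "0 < ?Y" using 3 ap bp by (metis powr_gt_zero less_irrefl)+
    have "?S \<le> (\<Sum>k\<in>A. (a + b) powr p * ((1 - t) * (\<bar>x k\<bar> powr p / ?X) + t * (\<bar>y k\<bar> powr p / ?Y)))"
      by (intro sum_mono pt)
    also have "\<dots> = (a + b) powr p * ((1 - t) * (?X / ?X) + t * (?Y / ?Y))"
      by (simp only: sum_distrib_left[symmetric] sum.distrib sum_divide_distrib[symmetric])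
    also have "\<dots> = (a + b) powr p" using pos by simp
    finally have "?S powr (1/p) \<le> ((a + b) powr p) powr (1/p)"
      using assms nonneg by (intro powr_mono2) auto
    then show ?thesis using assms nonneg 3 by (simp add: powr_powr a_def b_def)
  qed
qed

section \<open>Spaces containing an exact square\<close>

lemma Sup_ereal_eqI:
  fixes f :: "'a \<Rightarrow> 'b \<Rightarrow> real"
  assumes "\<And>x y. P x y \<Longrightarrow> f x y \<le> c" "P u v" "f u v = c"
  shows "Sup {ereal (f x y) | x y. P x y} = ereal c"
  using assms by (intro antisym Sup_least) (auto intro!: Sup_upper)

text \<open>
  A norm on \<open>X\<close>, reduced to the properties that the constants depend on, with unit vectors
  \<open>u\<close>, \<open>v\<close> whose sum and difference are as long as possible. Homogeneity would give \<open>nrm_diff\<close>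
  from \<open>nrm_add\<close>, but it needs a scalar multiplication, which the constants do not mention.
\<close>

locale exact_square =
  fixes X :: "'a::ab_group_add set" and nrm :: "'a \<Rightarrow> real" and u v :: 'a
  assumes nrm_nonneg: "0 \<le> nrm x"
    and nrm_pos: "x \<in> X \<Longrightarrow> x \<noteq> 0 \<Longrightarrow> 0 < nrm x"
    and nrm_add: "x \<in> X \<Longrightarrow> y \<in> X \<Longrightarrow> nrm (x + y) \<le> nrm x + nrm y"
    and nrm_diff: "x \<in> X \<Longrightarrow> y \<in> X \<Longrightarrow> nrm (x - y) \<le> nrm x + nrm y"
    and nrm_zero: "nrm 0 = 0"
    and uv_mem: "u \<in> X" "v \<in> X"
    and uv_unit: "nrm u = 1" "nrm v = 1"
    and uv_square: "nrm (u + v) = 2" "nrm (u - v) = 2"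
begin

lemma uv_nonzero: "u \<in> X - {0}" "v \<in> X - {0}"
  using uv_mem uv_unit nrm_zero by auto

lemma powr_bounds:
  assumes "1 \<le> s" "x \<in> X" "y \<in> X"
  shows "nrm (x + y) powr s \<le> 2 powr (s - 1) * (nrm x powr s + nrm y powr s)"
    and "nrm (x - y) powr s \<le> 2 powr (s - 1) * (nrm x powr s + nrm y powr s)"
proof -
  have *: "z powr s \<le> 2 powr (s - 1) * (nrm x powr s + nrm y powr s)"
    if "0 \<le> z" "z \<le> nrm x + nrm y" for z
    using powr_mono2[of s z "nrm x + nrm y"] add_powr_le[OF assms(1) nrm_nonneg nrm_nonneg, of x y]
      that assms(1) by linarith
  show "nrm (x + y) powr s \<le> 2 powr (s - 1) * (nrm x powr s + nrm y powr s)"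
    and "nrm (x - y) powr s \<le> 2 powr (s - 1) * (nrm x powr s + nrm y powr s)"
    using assms by (auto intro!: * nrm_nonneg nrm_add nrm_diff)
qed

lemma denominator_pos:
  assumes "x \<in> X - {0}" "y \<in> X - {0}"
  shows "0 < nrm x powr s + nrm y powr s"
  using assms nrm_pos[of x] by (intro add_pos_nonneg) auto

lemma gen_NJ_const_eq_2:
  assumes "1 \<le> s"
  shows "gen_NJ_const s X nrm = 2"
proof -
  have "gen_NJ_const s X nrm = ereal 2"
    unfolding gen_NJ_const_def
  proof (rule Sup_ereal_eqI[where u = u and v = v])
    fix x y assume xy: "x \<in> X - {0} \<and> y \<in> X - {0}"
    then show "(nrm (x + y) powr s + nrm (x - y) powr s)
        / (2 powr (s - 1) * (nrm x powr s + nrm y powr s)) \<le> 2"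
      using powr_bounds[OF assms, of x y] denominator_pos[of x y s]
      by (auto simp: pos_divide_le_eq)
  qed (use uv_nonzero in \<open>auto simp: uv_unit uv_square powr_diff\<close>)
  then show ?thesis by simp
qed

lemma gen_mod_NJ_const_eq_2:
  assumes "1 \<le> s"
  shows "gen_mod_NJ_const s X nrm = 2"
proof -
  have "gen_mod_NJ_const s X nrm = ereal 2"
    unfolding gen_mod_NJ_const_def
  proof (rule Sup_ereal_eqI[where u = u and v = v])
    fix x y assume xy: "x \<in> X \<and> y \<in> X \<and> nrm x = 1 \<and> nrm y = 1"
    then show "(nrm (x + y) powr s + nrm (x - y) powr s) / 2 powr s \<le> 2"
      using powr_bounds[OF assms, of x y] by (auto simp: powr_diff pos_divide_le_eq)
  qed (use uv_mem in \<open>auto simp: uv_unit uv_square\<close>)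
  then show ?thesis by simp
qed

lemma gen_NJ_type_const_eq_2:
  assumes "1 \<le> s"
  shows "gen_NJ_type_const s X nrm = 2"
proof -
  have "gen_NJ_type_const s X nrm = ereal 2"
    unfolding gen_NJ_type_const_def
  proof (rule Sup_ereal_eqI[where u = u and v = v])
    fix x y assume xy: "x \<in> X - {0} \<and> y \<in> X - {0}"
    then show "min (nrm (x + y) powr s) (nrm (x - y) powr s)
        / (2 powr (s - 2) * (nrm x powr s + nrm y powr s)) \<le> 2"
      using powr_bounds[OF assms, of x y] denominator_pos[of x y s]
      by (auto simp: pos_divide_le_eq powr_diff min_le_iff_disj)
  qed (use uv_nonzero in \<open>auto simp: uv_unit uv_square powr_diff\<close>)
  then show ?thesis by simp
qed

text \<open>
  The numerator is the geometric mean of \<open>\<parallel>x + y\<parallel>\<^sup>s\<close> and \<open>\<parallel>x - y\<parallel>\<^sup>s\<close>, so it satisfies any upper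
  bound that both of them satisfy.
\<close>

lemma gen_Zbaganu_const_eq_2:
  assumes "1 \<le> s"
  shows "gen_Zbaganu_const s X nrm = 2"
proof -
  have "gen_Zbaganu_const s X nrm = ereal 2"
    unfolding gen_Zbaganu_const_def
  proof (rule Sup_ereal_eqI[where u = u and v = v])
    fix x y assume xy: "x \<in> X - {0} \<and> y \<in> X - {0}"
    define D where "D = 2 powr (s - 1) * (nrm x powr s + nrm y powr s)"
    have half: "z powr (s / 2) \<le> sqrt D" if "z powr s \<le> D" for z
      using that by (intro real_le_rsqrt) (simp add: power2_eq_square powr_add[symmetric])
    have "nrm (x + y) powr (s / 2) * nrm (x - y) powr (s / 2) \<le> sqrt D * sqrt D"
      using powr_bounds[OF assms, of x y] xy by (intro mult_mono half) (auto simp: D_def)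
    also have "\<dots> = D" by (simp add: D_def)
    finally show "nrm (x + y) powr (s / 2) * nrm (x - y) powr (s / 2)
        / (2 powr (s - 2) * (nrm x powr s + nrm y powr s)) \<le> 2"
      using denominator_pos[of x y s] xy
      by (auto simp: pos_divide_le_eq powr_diff D_def mult_ac)
  qed (use uv_nonzero in \<open>auto simp: uv_unit uv_square powr_diff powr_add[symmetric]\<close>)
  then show ?thesis by simp
qed

text \<open>
  For \<open>s = 2\<close> the factor \<open>2\<^bsup>s-2\<^esup>\<close> in the generalised constants is \<open>1\<close> and \<open>2\<^sup>s\<close> is \<open>4\<close>, so the
  three classical constants are the case \<open>s = 2\<close> of the generalised ones.
\<close>

lemma mod_NJ_const_eq_2: "mod_NJ_const X nrm = 2"
  using gen_mod_NJ_const_eq_2[of 2]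
  by (simp add: mod_NJ_const_def gen_mod_NJ_const_def nrm_nonneg)

lemma NJ_type_const_eq_2: "NJ_type_const X nrm = 2"
  using gen_NJ_type_const_eq_2[of 2]
  by (simp add: NJ_type_const_def gen_NJ_type_const_def nrm_nonneg)

lemma Zbaganu_const_eq_2: "Zbaganu_const X nrm = 2"
  using gen_Zbaganu_const_eq_2[of 2]
  by (simp add: Zbaganu_const_def gen_Zbaganu_const_def nrm_nonneg)

end

section \<open>Cubes in the integer lattice\<close>

lemma mem_cube_iff: "k \<in> cube m N \<longleftrightarrow> (\<forall>j. \<bar>k $ j - m $ j\<bar> \<le> int N)"
proof -
  have "{\<bar>(k - m) $ j\<bar> | j. True} = range (\<lambda>j. \<bar>(k - m) $ j\<bar>)" by auto
  then show ?thesis by (simp add: cube_def linf_norm_def)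
qed

lemma finite_cube: "finite (cube m N)"
proof -
  have "cube m N \<subseteq> vec_lambda ` (\<Pi>\<^sub>E j\<in>UNIV. {m $ j - int N .. m $ j + int N})"
  proof
    fix k assume k: "k \<in> cube m N"
    have "(\<lambda>j. k $ j) \<in> (\<Pi>\<^sub>E j\<in>UNIV. {m $ j - int N .. m $ j + int N})"
      using k by (auto simp: mem_cube_iff PiE_iff) (smt (verit))+
    then show "k \<in> vec_lambda ` (\<Pi>\<^sub>E j\<in>UNIV. {m $ j - int N .. m $ j + int N})"
      by (metis image_eqI vec_nth_inverse)
  qed
  then show ?thesis by (rule finite_subset) (auto intro!: finite_PiE)
qed

lemma card_cube_ge_1: "1 \<le> card (cube m N)"
proof -
  have "m \<in> cube m N" by (simp add: mem_cube_iff)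
  then show ?thesis using finite_cube[of m N] by (metis One_nat_def Suc_leI card_gt_0_iff empty_iff)
qed

lemma cube_0: "cube m 0 = {m}"
  by (auto simp: mem_cube_iff vec_eq_iff)

definition diag :: "nat \<Rightarrow> int ^ 'd::finite" where
  "diag n = (\<chi> j. int n)"

lemma inj_diag: "inj (diag :: nat \<Rightarrow> int ^ 'd::finite)"
  by (auto simp: inj_on_def diag_def vec_eq_iff)

text \<open>
  Cubes are convex, so a cube containing two points of the main diagonal contains all diagonal
  points between them. This crude count suffices because only the growth of the cardinality with
  the distance \<open>n\<close> matters, not its exact order \<open>n\<^sup>d\<close>.
\<close>

lemma card_cube_ge_diag:
  fixes m :: "int ^ 'd::finite"
  assumes "diag 0 \<in> cube m N" "diag n \<in> cube m N"
  shows "n \<le> card (cube m N)"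
proof -
  have "diag ` {..<n} \<subseteq> cube m N"
  proof (clarsimp simp: mem_cube_iff diag_def)
    fix i j assume "i < n"
    then show "\<bar>int i - m $ j\<bar> \<le> int N"
      using assms[unfolded mem_cube_iff diag_def vec_lambda_beta, rule_format, of j] by linarith
  qed
  then have "card (diag ` {..<n} :: (int ^ 'd) set) \<le> card (cube m N)"
    by (intro card_mono finite_cube)
  moreover have "card (diag ` {..<n} :: (int ^ 'd) set) = n"
    by (simp add: card_image inj_on_subset[OF inj_diag subset_UNIV])
  ultimately show ?thesis by simp
qed

section \<open>The Morrey norm\<close>

definition cube_mean :: "real \<Rightarrow> real \<Rightarrow> (int ^ 'd::finite \<Rightarrow> real) \<Rightarrow> int ^ 'd \<Rightarrow> nat \<Rightarrow> real" where
  "cube_mean p q x m N = real (card (cube m N)) powr (1 / q - 1 / p)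
                 * (\<Sum>k\<in>cube m N. \<bar>x k\<bar> powr p) powr (1 / p)"

text \<open>
  Since \<open>p < q\<close>, the exponent is negative and small cubes weigh most.
\<close>

lemma cube_weight_le_1:
  assumes "1 \<le> p" "p < q"
  shows "real (card (cube m N)) powr (1 / q - 1 / p) \<le> 1"
proof -
  have "real (card (cube m N)) powr (1 / q - 1 / p) \<le> real (card (cube m N)) powr 0"
    using assms card_cube_ge_1[of m N] by (intro powr_mono) (auto simp: frac_le)
  then show ?thesis using card_cube_ge_1[of m N] by simp
qed

lemma cube_mean_nonneg: "0 \<le> cube_mean p q x m N"
  by (simp add: cube_mean_def)

lemma morrey_enorm_eq: "morrey_enorm p q x = (SUP (m, N). ereal (cube_mean p q x m N))"
  unfolding morrey_enorm_def cube_mean_def by (rule arg_cong[where f = Sup]) (auto simp: image_def)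

lemma morrey_enorm_nonneg: "0 \<le> morrey_enorm p q x"
  unfolding morrey_enorm_eq
  by (rule SUP_upper2[of "(0, 0)"]) (auto simp: cube_mean_nonneg)

lemma morrey_norm_nonneg: "0 \<le> morrey_norm p q x"
  by (simp add: morrey_norm_def morrey_enorm_nonneg real_of_ereal_pos)

lemma cube_mean_le_norm:
  assumes "x \<in> morrey_space p q"
  shows "cube_mean p q x m N \<le> morrey_norm p q x"
proof -
  have "ereal (cube_mean p q x m N) \<le> morrey_enorm p q x"
    unfolding morrey_enorm_eq by (rule SUP_upper2[of "(m, N)"]) auto
  also have "\<dots> = ereal (morrey_norm p q x)"
    using assms morrey_enorm_nonneg[of p q x]
    by (auto simp: morrey_space_def morrey_norm_def ereal_real)
  finally show ?thesis by simp
qed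

lemma morrey_norm_le:
  assumes "\<And>m N. cube_mean p q x m N \<le> c"
  shows "x \<in> morrey_space p q" "morrey_norm p q x \<le> c"
proof -
  have le: "morrey_enorm p q x \<le> ereal c"
    unfolding morrey_enorm_eq using assms by (auto intro!: SUP_least)
  then show "x \<in> morrey_space p q" by (auto simp: morrey_space_def)
  show "morrey_norm p q x \<le> c"
    using le morrey_enorm_nonneg[of p q x] unfolding morrey_norm_def
    by (cases "morrey_enorm p q x") auto
qed

lemma morrey_norm_add_le:
  assumes "1 \<le> p" "x \<in> morrey_space p q" "y \<in> morrey_space p q"
  shows "morrey_norm p q (x + y) \<le> morrey_norm p q x + morrey_norm p q y"
proof (rule morrey_norm_le)
  fix m N
  have "cube_mean p q (x + y) m N \<le> cube_mean p q x m N + cube_mean p q y m N"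
    unfolding cube_mean_def distrib_left[symmetric] plus_fun_apply
    by (intro mult_left_mono Minkowski_sum assms finite_cube) auto
  also have "\<dots> \<le> morrey_norm p q x + morrey_norm p q y"
    by (intro add_mono cube_mean_le_norm assms)
  finally show "cube_mean p q (x + y) m N \<le> morrey_norm p q x + morrey_norm p q y" .
qed

lemma morrey_norm_minus: "morrey_norm p q (- x) = morrey_norm p q x"
  by (simp add: morrey_norm_def morrey_enorm_def)

lemma morrey_space_minus: "x \<in> morrey_space p q \<Longrightarrow> - x \<in> morrey_space p q"
  by (simp add: morrey_space_def morrey_enorm_def)

text \<open>
  Take the cube of radius \<open>0\<close> around \<open>k\<close>. This makes the norm definite, and it gives the lower
  bounds for the norms of the point masses below.
\<close>

lemma abs_le_morrey_norm:
  assumes "1 \<le> p" "x \<in> morrey_space p q"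
  shows "\<bar>x k\<bar> \<le> morrey_norm p q x"
  using cube_mean_le_norm[OF assms(2), of k 0] assms(1)
  by (simp add: cube_mean_def cube_0 powr_powr)

lemma morrey_norm_zero: "morrey_norm p q 0 = 0"
  by (intro antisym morrey_norm_le(2) morrey_norm_nonneg) (simp add: cube_mean_def)

section \<open>Two distant point masses\<close>

definition point_mass :: "'a \<Rightarrow> real \<Rightarrow> 'a \<Rightarrow> real" where
  "point_mass a c = (\<lambda>k. if k = a then c else 0)"

lemma morrey_norm_point_mass:
  assumes "1 \<le> p" "p < q"
  shows "morrey_norm p q (point_mass a c) = \<bar>c\<bar>"
proof (rule antisym)
  have le: "cube_mean p q (point_mass a c) m N \<le> \<bar>c\<bar>" for m N
  proof -
    have "(\<Sum>k\<in>cube m N. \<bar>point_mass a c k\<bar> powr p) = (\<Sum>k\<in>cube m N. if k = a then \<bar>c\<bar> powr p else 0)"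
      by (intro sum.cong) (auto simp: point_mass_def)
    also have "\<dots> \<le> \<bar>c\<bar> powr p" by (simp add: finite_cube)
    finally have "(\<Sum>k\<in>cube m N. \<bar>point_mass a c k\<bar> powr p) powr (1/p) \<le> (\<bar>c\<bar> powr p) powr (1/p)"
      using assms by (intro powr_mono2 sum_nonneg) auto
    then have 1: "(\<Sum>k\<in>cube m N. \<bar>point_mass a c k\<bar> powr p) powr (1/p) \<le> \<bar>c\<bar>"
      using assms by (simp add: powr_powr)
    show ?thesis using mult_mono[OF cube_weight_le_1[OF assms, of m N] 1] by (simp add: cube_mean_def)
  qed
  show "morrey_norm p q (point_mass a c) \<le> \<bar>c\<bar>" by (rule morrey_norm_le(2)[OF le])
  show "\<bar>c\<bar> \<le> morrey_norm p q (point_mass a c)"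
    using abs_le_morrey_norm[OF assms(1) morrey_norm_le(1)[OF le], of a] by (simp add: point_mass_def)
qed

definition point_pair :: "nat \<Rightarrow> real \<Rightarrow> int ^ 'd::finite \<Rightarrow> real" where
  "point_pair n c = point_mass (diag 0) 1 + point_mass (diag n) c"

text \<open>
  A cube that contains at most one of the two points has weight at most \<open>1\<close> and sees mass at most
  \<open>1\<close>. A cube that contains both has at least \<open>n\<close> elements, and the assumption \<open>far\<close> says that
  \<open>n\<close> is so large that the resulting weight absorbs the factor \<open>2\<^bsup>1/p\<^esup>\<close>.
\<close>

lemma morrey_norm_point_pair:
  assumes "1 \<le> p" "p < q" "\<bar>c\<bar> = 1" "0 < n"
    and far: "2 powr (1 / p) \<le> real n powr (1 / p - 1 / q)"
  shows "(point_pair n c :: int ^ 'd::finite \<Rightarrow> real) \<in> morrey_space p q"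
    and "morrey_norm p q (point_pair n c :: int ^ 'd::finite \<Rightarrow> real) = 1"
proof -
  let ?x = "point_pair n c :: int ^ 'd \<Rightarrow> real"
  have diag_neq: "diag n \<noteq> (diag 0 :: int ^ 'd)"
    using \<open>0 < n\<close> inj_diag by (metis injD less_irrefl)
  have exponent: "1 / q - 1 / p \<le> 0" using assms by (simp add: frac_le)
  have le: "cube_mean p q ?x m N \<le> 1" for m N
  proof -
    have "(\<Sum>k\<in>cube m N. \<bar>?x k\<bar> powr p) = (\<Sum>k\<in>cube m N. if k \<in> {diag 0, diag n} then 1 else 0)"
      using diag_neq assms by (intro sum.cong) (auto simp: point_pair_def point_mass_def)
    also have "\<dots> = real (card (cube m N \<inter> {diag 0, diag n}))"
      by (simp add: sum.If_cases finite_cube del: insert_iff)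
    finally have mean: "cube_mean p q ?x m N = real (card (cube m N)) powr (1 / q - 1 / p)
        * real (card (cube m N \<inter> {diag 0, diag n})) powr (1 / p)"
      by (simp add: cube_mean_def)
    show ?thesis
    proof (cases "diag 0 \<in> cube m N \<and> diag n \<in> cube m N")
      case True
      then have "n \<le> card (cube m N)" by (intro card_cube_ge_diag) auto
      then have "real (card (cube m N)) powr (1 / q - 1 / p) \<le> real n powr (1 / q - 1 / p)"
        using exponent \<open>0 < n\<close> by (intro powr_mono2') auto
      moreover have "cube m N \<inter> {diag 0, diag n} = {diag 0, diag n}" using True by auto
      then have "real (card (cube m N \<inter> {diag 0, diag n})) powr (1 / p) \<le> real n powr (1 / p - 1 / q)"
        using far diag_neq by (simp add: card_insert_if)
      ultimately have "cube_mean p q ?x m N \<le> real n powr (1 / q - 1 / p) * real n powr (1 / p - 1 / q)"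
        unfolding mean by (intro mult_mono) auto
      also have "\<dots> = 1" using \<open>0 < n\<close> by (simp add: powr_add[symmetric])
      finally show ?thesis .
    next
      case False
      then have "cube m N \<inter> {diag 0, diag n} \<subseteq> {diag 0} \<or> cube m N \<inter> {diag 0, diag n} \<subseteq> {diag n}"
        by auto
      then have "card (cube m N \<inter> {diag 0, diag n}) \<le> 1"
      proof
        assume "cube m N \<inter> {diag 0, diag n} \<subseteq> {diag 0}"
        from card_mono[OF _ this] show ?thesis by simp
      next
        assume "cube m N \<inter> {diag 0, diag n} \<subseteq> {diag n}"
        from card_mono[OF _ this] show ?thesis by simp
      qed
      then have 1: "real (card (cube m N \<inter> {diag 0, diag n})) powr (1 / p) \<le> 1"
        using assms by (intro powr_le1) auto
      show ?thesis
        using mult_mono[OF cube_weight_le_1[OF assms(1,2), of m N] 1] by (simp add: mean)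
    qed
  qed
  show mem: "?x \<in> morrey_space p q" by (rule morrey_norm_le(1)[OF le])
  have "1 \<le> morrey_norm p q ?x"
    using abs_le_morrey_norm[OF assms(1) mem, of "diag 0"] diag_neq
    by (simp add: point_pair_def point_mass_def)
  then show "morrey_norm p q ?x = 1" using morrey_norm_le(2)[OF le] by (intro antisym)
qed

lemma exact_square_morrey:
  assumes "1 \<le> p" "p < q"
  obtains u v :: "int ^ 'd::finite \<Rightarrow> real"
  where "exact_square (morrey_space p q) (morrey_norm p q) u v"
proof -
  define r where "r = 1 / p - 1 / q"
  have r: "0 < r" using assms by (simp add: r_def field_simps)
  \<comment> \<open>The threshold solves \<open>n\<^sup>r = 2\<^bsup>1/p\<^esup>\<close> for \<open>n\<close>.\<close>
  obtain n :: nat where n: "2 powr (1 / p / r) < real n" using reals_Archimedean2 by blast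
  have "0 < real n" by (rule order_le_less_trans[OF _ n]) simp
  then have "0 < n" by simp
  have "2 powr (1 / p) = (2 powr (1 / p / r)) powr r" using r by (simp add: powr_powr)
  also have "\<dots> \<le> real n powr r" using n r by (intro powr_mono2) auto
  finally have far: "2 powr (1 / p) \<le> real n powr (1 / p - 1 / q)" by (simp add: r_def)
  let ?u = "point_pair n 1 :: int ^ 'd \<Rightarrow> real" and ?v = "point_pair n (-1) :: int ^ 'd \<Rightarrow> real"
  have pair: "?u \<in> morrey_space p q" "morrey_norm p q ?u = 1"
      "?v \<in> morrey_space p q" "morrey_norm p q ?v = 1"
    by (rule morrey_norm_point_pair[OF assms _ \<open>0 < n\<close> far]; simp)+
  have sum: "?u + ?v = point_mass (diag 0) 2" and diff: "?u - ?v = point_mass (diag n) 2"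
    by (auto simp: point_pair_def point_mass_def fun_eq_iff)
  have "exact_square (morrey_space p q) (morrey_norm p q) ?u ?v"
  proof
    fix x y :: "int ^ 'd \<Rightarrow> real"
    show "0 \<le> morrey_norm p q x" by (rule morrey_norm_nonneg)
    show "0 < morrey_norm p q x" if x: "x \<in> morrey_space p q" "x \<noteq> 0"
    proof -
      obtain k where "x k \<noteq> 0" using x(2) by (auto simp: fun_eq_iff)
      then show ?thesis using abs_le_morrey_norm[OF assms(1) x(1), of k] by linarith
    qed
    assume x: "x \<in> morrey_space p q" and y: "y \<in> morrey_space p q"
    show "morrey_norm p q (x + y) \<le> morrey_norm p q x + morrey_norm p q y"
      by (rule morrey_norm_add_le[OF assms(1) x y])
    show "morrey_norm p q (x - y) \<le> morrey_norm p q x + morrey_norm p q y"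
      using morrey_norm_add_le[OF assms(1) x morrey_space_minus[OF y]]
      by (simp add: morrey_norm_minus)
  next
    show "morrey_norm p q (?u + ?v) = 2" "morrey_norm p q (?u - ?v) = 2"
      unfolding sum diff by (simp_all add: morrey_norm_point_mass[OF assms])
  qed (use pair in \<open>auto simp: morrey_norm_zero\<close>)
  then show ?thesis by (rule that)
qed

theorem theorem2p1:
  fixes p q s :: real
    and X :: "(int ^ 'd::finite \<Rightarrow> real) set"
    and nrm :: "(int ^ 'd::finite \<Rightarrow> real) \<Rightarrow> real"
  defines "X \<equiv> morrey_space p q"
    and "nrm \<equiv> morrey_norm p q"
  assumes "1 \<le> p" and "p < q" and "1 \<le> s"
  shows "gen_NJ_const s X nrm = 2
       \<and> mod_NJ_const X nrm = 2
       \<and> gen_mod_NJ_const s X nrm = 2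
       \<and> NJ_type_const X nrm = 2
       \<and> gen_NJ_type_const s X nrm = 2
       \<and> Zbaganu_const X nrm = 2
       \<and> gen_Zbaganu_const s X nrm = 2"
proof -
  obtain u v :: "int ^ 'd \<Rightarrow> real" where "exact_square X nrm u v"
    using exact_square_morrey[OF assms(3,4)] unfolding X_def nrm_def by blast
  then interpret exact_square X nrm u v .
  show ?thesis
    using gen_NJ_const_eq_2[OF assms(5)] mod_NJ_const_eq_2 gen_mod_NJ_const_eq_2[OF assms(5)]
      NJ_type_const_eq_2 gen_NJ_type_const_eq_2[OF assms(5)] Zbaganu_const_eq_2
      gen_Zbaganu_const_eq_2[OF assms(5)]
    by blast
qed

end
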